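(* Let $\{\mathcal{M}_k\}_{k=1}^L$ be a sequentially nested model class such that for every $k\in\{1,\dots,L\}$ the class of loss functions $\mathcal{L}_k=\{l(\cdot,\boldsymbol\theta_k):\boldsymbol\theta_k\in\mathcal{H}_k\}$ is Glivenko–Cantelli, and let $K$ be the index of its most parsimonious model containing a global risk minimizer. For every $k\in\{2,\dots,L\}$ let $\gamma_k(n,\delta,S_n)$ be a function of order $o(1)$ for which there is a positive integer $N$ such that for all $n\ge N$ and $0<\delta\le1$, $$\mathbb{P}\Big\{\big|R_{emp}(S_n,\hat{\boldsymbol\theta}_{k-1})-R_{emp}(S_n,\hat{\boldsymbol\theta}_k)-R(\boldsymbol\theta_{k-1}^* )+R(\boldsymbol\theta_k^* )\big|\le\gamma_k(n,\delta,S_n)\Big\}\ge1-\delta.$$ Then: 1) (when $K\ge2$) for every $0<\delta\le1$ there is a positive integer $N_K\ge1$ such that for every $n\ge N_K$, with probability at least $1-\delta$, $$R_{emp}(S_n,\hat{\boldsymbol\theta}_{K-1})-R_{emp}(S_n,\hat{\boldsymbol\theta}_K)\ge\gamma_K(n,\delta,S_n);$$ 2) for every $0<\delta\le1$ and every $k$ with $K<k\le L$ there is a positive integer $N_k$ such that for every $n\ge N_k$, with probability at least $1-\delta$, $$R_{emp}(S_n,\hat{\boldsymbol\theta}_{k-1})-R_{emp}(S_n,\hat{\boldsymbol\theta}_k)\le\gamma_k(n,\delta,S_n).$$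
   Context: Setting: $S_n=(\mathbf{z}_1,\dots,\mathbf{z}_n)$ consists of $n$ i.i.d. copies of a random element $\mathbf{Z}$ with unknown distribution $\mathcal{P}$ (on $\mathcal{X}\subset\mathbb{R}^p$ with $\mathbf{z}=\mathbf{x}$ in the unsupervised case, or on $\mathcal{X}\times\mathcal{Y}$, $\mathcal{Y}\subset\mathbb{R}^q$, with $\mathbf{z}=(\mathbf{x},\mathbf{y})$ in the supervised case). A model $\mathcal{M}_k=\{f_{\boldsymbol\theta_k}:\boldsymbol\theta_k\in\mathcal{H}_k\}$ is a set of functions (probability densities or conditional densities / predictors) with parameter space $\mathcal{H}_k$. The nonnegative loss $l(\mathbf{z},\boldsymbol\theta)$ stands for $l(f_{\boldsymbol\theta}(\mathbf{x}))$ or $l(f_{\boldsymbol\theta}(\mathbf{x}),\mathbf{y})$, so it depends on $\boldsymbol\theta$ only through $f_{\boldsymbol\theta}$. The risk is $R(\boldsymbol\theta)=\mathbb{E}\{l(\mathbf{Z},\boldsymbol\theta)\}$ and the empirical risk is $R_{emp}(S_n,\boldsymbol\theta)=\frac1n\sum_{i=1}^n l(\mathbf{z}_i,\boldsymbol\theta)$. For each model, $\boldsymbol\theta_k^*\in\arg\min_{\boldsymbol\theta_k\in\mathcal{H}_k}R(\boldsymbol\theta_k)$ and $\hat{\boldsymbol\theta}_k\in\arg\min_{\boldsymbol\theta_k\in\mathcal{H}_k}R_{emp}(S_n,\boldsymbol\theta_k)$ (minimizers are assumed to exist). Glivenko–Cantelli: a class $\mathcal{F}$ is Glivenko–Cantelli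 for the distribution of $\mathbf{Z}$ if for every $\varepsilon>0$, $\lim_{n\to\infty}\mathbb{P}\{\sup_{f\in\mathcal{F}}|\frac1n\sum_{i=1}^n f(\mathbf{z}_i)-\mathbb{E}\{f(\mathbf{Z})\}|>\varepsilon\}=0$. Nested: $\mathcal{M}_i$ is nested in $\mathcal{M}_j$ if for all $\boldsymbol\theta_i\in\mathcal{H}_i$ there is $\boldsymbol\theta_j\in\mathcal{H}_j$ (not necessarily equal to $\boldsymbol\theta_i$) with $f_{\boldsymbol\theta_i}=f_{\boldsymbol\theta_j}$ (pointwise equality everywhere). A model class $\{\mathcal{M}_k\}_{k=1}^L$, $L>2$, is sequentially nested if $\mathcal{M}_i$ is nested in $\mathcal{M}_j$ for all $1\le i\le j\le L$. Index $K$: a global risk minimizer $f_{\boldsymbol\theta^*}$ is a function in $\bigcup_k\mathcal{M}_k$ of minimum risk over all models of the class; $K$ is the index such that $\mathcal{M}_K$ contains a global risk minimizer and either $K=1$ or $\mathcal{M}_{K-1}$ contains none. $\mathcal{M}_K$ is called the most parsimonious model containing a global risk minimizer. Order $o(1)$: for every fixed $\delta\in(0,1]$ and every $\varepsilon>0$ there is $n_0$ such that $\gamma_k(n,\delta,S_n)\le\varepsilon$ for all $n\ge n_0$. Although $S_n$ appears as an argument in the notation, $\gamma_k$ is a deterministic function. *)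

theory Defs
  imports "HOL-Probability.Probability"
begin

(* Events about suprema over a class of functions, or about an arbitrary choice of minimizers,
   need not be measurable, while measure M A = 0 by convention for every A that is not
   measurable.  "Small probability" is therefore read through outer_measure_of and "probability
   at least" through the inner probability below; both agree with the ordinary probability on
   measurable events. *)

definition inner_prob :: "'w measure \<Rightarrow> 'w set \<Rightarrow> real" where
  "inner_prob M A = (SUP B\<in>{B \<in> sets M. B \<subseteq> A}. measure M B)"

lemma inner_prob_eq_measure:
  assumes "finite_measure M" "A \<in> sets M"
  shows "inner_prob M A = measure M A"
  unfolding inner_prob_def
  using assms by (intro cSup_eq_maximum) (auto intro: finite_measure.finite_measure_mono)

lemma inner_prob_mono:
  assumes "finite_measure M" "A \<subseteq> B"
  shows "inner_prob M A \<le> inner_prob M B"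
  unfolding inner_prob_def
  using assms
  by (intro cSUP_subset_mono)
     (auto intro!: bdd_aboveI[of _ "measure M (space M)"] finite_measure.bounded_measure)

definition iid_with_law :: "'w measure \<Rightarrow> 'z measure \<Rightarrow> (nat \<Rightarrow> 'w \<Rightarrow> 'z) \<Rightarrow> bool" where
  "iid_with_law M P Z \<longleftrightarrow>
     prob_space.indep_vars M (\<lambda>_. P) Z {1..} \<and> (\<forall>i\<ge>1. distr M P (Z i) = P)"

definition sample :: "(nat \<Rightarrow> 'w \<Rightarrow> 'z) \<Rightarrow> nat \<Rightarrow> 'w \<Rightarrow> 'z list" where
  "sample Z n \<omega> = map (\<lambda>i. Z i \<omega>) [1..<Suc n]"

definition empirical_mean :: "'z list \<Rightarrow> ('z \<Rightarrow> real) \<Rightarrow> real" where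
  "empirical_mean S h = (\<Sum>z\<leftarrow>S. h z) / real (length S)"

(* The loss value l r z depends on the prediction r = g (cov z) and on the observation z.
   Supervised case: z = (x, y), cov = fst, and l r z = l' r (snd z).
   Unsupervised case: z = x, cov = id, and l r z = l' r. *)

definition loss_at :: "('z \<Rightarrow> 'x) \<Rightarrow> ('r \<Rightarrow> 'z \<Rightarrow> real) \<Rightarrow> ('x \<Rightarrow> 'r) \<Rightarrow> 'z \<Rightarrow> real" where
  "loss_at cov l g z = l (g (cov z)) z"

definition risk :: "'z measure \<Rightarrow> ('z \<Rightarrow> 'x) \<Rightarrow> ('r \<Rightarrow> 'z \<Rightarrow> real) \<Rightarrow> ('x \<Rightarrow> 'r) \<Rightarrow> real" where
  "risk P cov l g = (\<integral>z. loss_at cov l g z \<partial>P)"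

definition emp_risk :: "('z \<Rightarrow> 'x) \<Rightarrow> ('r \<Rightarrow> 'z \<Rightarrow> real) \<Rightarrow> 'z list \<Rightarrow> ('x \<Rightarrow> 'r) \<Rightarrow> real" where
  "emp_risk cov l S g = empirical_mean S (loss_at cov l g)"

(* The expectations of the members of the class have to exist; for non-integrable functions
   the Bochner integral would be 0.  The supremum is taken in ennreal, so that it is
   meaningful for unbounded families. *)

definition glivenko_cantelli ::
  "'w measure \<Rightarrow> 'z measure \<Rightarrow> (nat \<Rightarrow> 'w \<Rightarrow> 'z) \<Rightarrow> ('z \<Rightarrow> real) set \<Rightarrow> bool" where
  "glivenko_cantelli M P Z F \<longleftrightarrow>
     (\<forall>h\<in>F. integrable P h) \<and>
     (\<forall>\<epsilon>>0. (\<lambda>n. outer_measure_of M {\<omega> \<in> space M.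
         (SUP h\<in>F. ennreal \<bar>empirical_mean (sample Z n \<omega>) h - (\<integral>z. h z \<partial>P)\<bar>) > ennreal \<epsilon>})
       \<longlonglongrightarrow> 0)"

definition model :: "(nat \<Rightarrow> 'p \<Rightarrow> 'x \<Rightarrow> 'r) \<Rightarrow> (nat \<Rightarrow> 'p set) \<Rightarrow> nat \<Rightarrow> ('x \<Rightarrow> 'r) set" where
  "model f H k = f k ` H k"

definition nested ::
  "'x set \<Rightarrow> (nat \<Rightarrow> 'p \<Rightarrow> 'x \<Rightarrow> 'r) \<Rightarrow> (nat \<Rightarrow> 'p set) \<Rightarrow> nat \<Rightarrow> nat \<Rightarrow> bool" where
  "nested X f H i j \<longleftrightarrow> (\<forall>\<theta>\<^sub>i\<in>H i. \<exists>\<theta>\<^sub>j\<in>H j. \<forall>x\<in>X. f i \<theta>\<^sub>i x = f j \<theta>\<^sub>j x)"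

definition sequentially_nested ::
  "'x set \<Rightarrow> (nat \<Rightarrow> 'p \<Rightarrow> 'x \<Rightarrow> 'r) \<Rightarrow> (nat \<Rightarrow> 'p set) \<Rightarrow> nat \<Rightarrow> bool" where
  "sequentially_nested X f H L \<longleftrightarrow>
     L > 2 \<and> (\<forall>i j. 1 \<le> i \<and> i \<le> j \<and> j \<le> L \<longrightarrow> nested X f H i j)"

definition global_risk_minimizer ::
  "'z measure \<Rightarrow> ('z \<Rightarrow> 'x) \<Rightarrow> ('r \<Rightarrow> 'z \<Rightarrow> real) \<Rightarrow> (nat \<Rightarrow> 'p \<Rightarrow> 'x \<Rightarrow> 'r) \<Rightarrow> (nat \<Rightarrow> 'p set)
     \<Rightarrow> nat \<Rightarrow> ('x \<Rightarrow> 'r) \<Rightarrow> bool" where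
  "global_risk_minimizer P cov l f H L g \<longleftrightarrow>
     is_arg_min (risk P cov l) (\<lambda>g. g \<in> (\<Union>k\<in>{1..L}. model f H k)) g"

definition most_parsimonious_index ::
  "'z measure \<Rightarrow> ('z \<Rightarrow> 'x) \<Rightarrow> ('r \<Rightarrow> 'z \<Rightarrow> real) \<Rightarrow> (nat \<Rightarrow> 'p \<Rightarrow> 'x \<Rightarrow> 'r) \<Rightarrow> (nat \<Rightarrow> 'p set)
     \<Rightarrow> nat \<Rightarrow> nat \<Rightarrow> bool" where
  "most_parsimonious_index P cov l f H L K \<longleftrightarrow>
     K \<in> {1..L} \<and>
     (\<exists>g\<in>model f H K. global_risk_minimizer P cov l f H L g) \<and>
     (K = 1 \<or> \<not> (\<exists>g\<in>model f H (K - 1). global_risk_minimizer P cov l f H L g))"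

definition order_o1 :: "(nat \<Rightarrow> real \<Rightarrow> real) \<Rightarrow> bool" where
  "order_o1 \<gamma> \<longleftrightarrow> (\<forall>\<delta>. 0 < \<delta> \<and> \<delta> \<le> 1 \<longrightarrow> (\<forall>\<epsilon>>0. \<exists>n\<^sub>0. \<forall>n\<ge>n\<^sub>0. \<gamma> n \<delta> \<le> \<epsilon>))"

end

theory Submission
  imports Defs
begin

text \<open>Beyond \<open>K\<close> the minimal risks of consecutive models agree, so the deviation
  event is already a bound on the difference of empirical risks. At \<open>K\<close> the minimal risk drops by
  some \<open>\<epsilon> > 0\<close>, and as soon as \<open>\<gamma>\<^sub>K \<le> \<epsilon> / 2\<close> the deviation event gives a difference of at
  least \<open>\<epsilon> - \<gamma>\<^sub>K \<ge> \<gamma>\<^sub>K\<close>.\<close>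

text \<open>Nestedness provides equality of functions on \<open>X\<close> alone. This suffices for
  equal risks, because the integrand evaluates a function only at points \<open>cov z\<close> with
  \<open>z\<close> in \<open>space P\<close>, and \<open>cov\<close> maps these into
  \<open>X\<close>.\<close>

lemma risk_cong:
  assumes "cov \<in> space P \<rightarrow> X" "\<And>x. x \<in> X \<Longrightarrow> g x = h x"
  shows "risk P cov l g = risk P cov l h"
  unfolding risk_def loss_at_def
  using assms by (intro Bochner_Integration.integral_cong) (auto simp: Pi_iff)

text \<open>The function of the minimizer in the smaller model is reproduced on \<open>X\<close> by
  some parameter of the larger one, which then competes in the larger minimization with the same
  risk.\<close>

lemma min_risk_antimono:
  assumes nested: "nested X f H i j" and cov: "cov \<in> space P \<rightarrow> X"
    and i: "is_arg_min (\<lambda>\<theta>. risk P cov l (f i \<theta>)) (\<lambda>\<theta>. \<theta> \<in> H i) \<theta>\<^sub>i"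
    and j: "is_arg_min (\<lambda>\<theta>. risk P cov l (f j \<theta>)) (\<lambda>\<theta>. \<theta> \<in> H j) \<theta>\<^sub>j"
  shows "risk P cov l (f j \<theta>\<^sub>j) \<le> risk P cov l (f i \<theta>\<^sub>i)"
proof -
  from nested i obtain \<theta> where "\<theta> \<in> H j" and eq: "\<And>x. x \<in> X \<Longrightarrow> f i \<theta>\<^sub>i x = f j \<theta> x"
    unfolding nested_def is_arg_min_linorder by blast
  then have "risk P cov l (f j \<theta>\<^sub>j) \<le> risk P cov l (f j \<theta>)"
    using j by (simp add: is_arg_min_linorder)
  also have "\<dots> = risk P cov l (f i \<theta>\<^sub>i)"
    using risk_cong[OF cov eq] by simp
  finally show ?thesis .
qed

text \<open>The global minimizer contained in model \<open>K\<close> may belong to a parameter other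
  than the given one. That parameter lies in \<open>H K\<close>, however, so the given minimizer
  over \<open>H K\<close> does at least as well and inherits the global lower bound.\<close>

lemma min_risk_le_if_most_parsimonious:
  assumes K: "most_parsimonious_index P cov l f H L K"
    and min: "is_arg_min (\<lambda>\<theta>. risk P cov l (f K \<theta>)) (\<lambda>\<theta>. \<theta> \<in> H K) \<theta>\<^sub>K"
    and "k \<in> {1..L}" "\<theta> \<in> H k"
  shows "risk P cov l (f K \<theta>\<^sub>K) \<le> risk P cov l (f k \<theta>)"
proof -
  from K obtain \<eta> where "\<eta> \<in> H K" and glob: "global_risk_minimizer P cov l f H L (f K \<eta>)"
    unfolding most_parsimonious_index_def model_def by blast
  then have "risk P cov l (f K \<theta>\<^sub>K) \<le> risk P cov l (f K \<eta>)"
    using min by (simp add: is_arg_min_linorder)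
  also have "\<dots> \<le> risk P cov l (f k \<theta>)"
    using glob assms(3,4)
    unfolding global_risk_minimizer_def is_arg_min_linorder model_def by blast
  finally show ?thesis .
qed

text \<open>If some parameter of model \<open>K - 1\<close> did as well as the minimizer over
  \<open>H K\<close>, its function would have the least risk among all models and so be a global
  risk minimizer in model \<open>K - 1\<close>. For \<open>K \<ge> 2\<close> the definition of the
  index excludes this.\<close>

lemma min_risk_less_if_most_parsimonious:
  assumes K: "most_parsimonious_index P cov l f H L K" and "K \<ge> 2"
    and min: "is_arg_min (\<lambda>\<theta>. risk P cov l (f K \<theta>)) (\<lambda>\<theta>. \<theta> \<in> H K) \<theta>\<^sub>K"
    and "\<theta> \<in> H (K - 1)"
  shows "risk P cov l (f K \<theta>\<^sub>K) < risk P cov l (f (K - 1) \<theta>)"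
proof (rule ccontr)
  assume "\<not> ?thesis"
  then have le: "risk P cov l (f (K - 1) \<theta>) \<le> risk P cov l (f K \<theta>\<^sub>K)" by simp
  have "K - 1 \<in> {1..L}"
    using K \<open>K \<ge> 2\<close> by (auto simp: most_parsimonious_index_def)
  then have "f (K - 1) \<theta> \<in> (\<Union>k\<in>{1..L}. model f H k)"
    using \<open>\<theta> \<in> H (K - 1)\<close> unfolding model_def by blast
  moreover have "risk P cov l (f (K - 1) \<theta>) \<le> risk P cov l g"
    if "g \<in> (\<Union>k\<in>{1..L}. model f H k)" for g
    using that le min_risk_le_if_most_parsimonious[OF K min]
    unfolding model_def by (blast intro: order.trans)
  ultimately have "global_risk_minimizer P cov l f H L (f (K - 1) \<theta>)"
    by (simp add: global_risk_minimizer_def is_arg_min_linorder)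
  then show False
    using K \<open>K \<ge> 2\<close> \<open>\<theta> \<in> H (K - 1)\<close>
    unfolding most_parsimonious_index_def model_def by auto
qed

theorem corollary4:
  fixes M :: "'w measure"
    and P :: "'z::euclidean_space measure"
    and Z :: "nat \<Rightarrow> 'w \<Rightarrow> 'z"
    and X :: "'x::euclidean_space set"
    and cov :: "'z \<Rightarrow> 'x"
    and l :: "'r \<Rightarrow> 'z \<Rightarrow> real"
    and f :: "nat \<Rightarrow> 'p \<Rightarrow> 'x \<Rightarrow> 'r"
    and H :: "nat \<Rightarrow> 'p set"
    and L K :: nat
    and \<theta>star :: "nat \<Rightarrow> 'p"
    and \<theta>hat :: "nat \<Rightarrow> 'z list \<Rightarrow> 'p"
    and \<gamma> :: "nat \<Rightarrow> nat \<Rightarrow> real \<Rightarrow> real"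
  assumes prob_M: "prob_space M"
    and prob_P: "prob_space P"
    and sets_P: "sets P = sets (restrict_space borel (space P))"
    and iid: "iid_with_law M P Z"
    and cov: "cov \<in> space P \<rightarrow> X"
    and loss_nonneg: "\<And>k \<theta> z. k \<in> {1..L} \<Longrightarrow> \<theta> \<in> H k \<Longrightarrow> z \<in> space P \<Longrightarrow>
      0 \<le> loss_at cov l (f k \<theta>) z"
    and risk_min: "\<And>k. k \<in> {1..L} \<Longrightarrow>
      is_arg_min (\<lambda>\<theta>. risk P cov l (f k \<theta>)) (\<lambda>\<theta>. \<theta> \<in> H k) (\<theta>star k)"
    and emp_risk_min: "\<And>k n \<omega>. k \<in> {1..L} \<Longrightarrow> n \<ge> 1 \<Longrightarrow> \<omega> \<in> space M \<Longrightarrow>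
      is_arg_min (\<lambda>\<theta>. emp_risk cov l (sample Z n \<omega>) (f k \<theta>)) (\<lambda>\<theta>. \<theta> \<in> H k)
        (\<theta>hat k (sample Z n \<omega>))"
    and nested: "sequentially_nested X f H L"
    and gc: "\<And>k. k \<in> {1..L} \<Longrightarrow>
      glivenko_cantelli M P Z ((\<lambda>\<theta>. loss_at cov l (f k \<theta>)) ` H k)"
    and K: "most_parsimonious_index P cov l f H L K"
    and o1: "\<And>k. k \<in> {2..L} \<Longrightarrow> order_o1 (\<gamma> k)"
    and bound: "\<And>k. k \<in> {2..L} \<Longrightarrow> \<exists>N\<ge>1. \<forall>n\<ge>N. \<forall>\<delta>. 0 < \<delta> \<and> \<delta> \<le> 1 \<longrightarrow>
      inner_prob M {\<omega> \<in> space M.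
        \<bar>emp_risk cov l (sample Z n \<omega>) (f (k - 1) (\<theta>hat (k - 1) (sample Z n \<omega>)))
          - emp_risk cov l (sample Z n \<omega>) (f k (\<theta>hat k (sample Z n \<omega>)))
          - risk P cov l (f (k - 1) (\<theta>star (k - 1)))
          + risk P cov l (f k (\<theta>star k))\<bar> \<le> \<gamma> k n \<delta>} \<ge> 1 - \<delta>"
  shows "(K \<ge> 2 \<longrightarrow> (\<forall>\<delta>. 0 < \<delta> \<and> \<delta> \<le> 1 \<longrightarrow> (\<exists>N\<ge>1. \<forall>n\<ge>N.
      inner_prob M {\<omega> \<in> space M.
        emp_risk cov l (sample Z n \<omega>) (f (K - 1) (\<theta>hat (K - 1) (sample Z n \<omega>)))
          - emp_risk cov l (sample Z n \<omega>) (f K (\<theta>hat K (sample Z n \<omega>)))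
        \<ge> \<gamma> K n \<delta>} \<ge> 1 - \<delta>)))
    \<and> (\<forall>\<delta> k. 0 < \<delta> \<and> \<delta> \<le> 1 \<and> K < k \<and> k \<le> L \<longrightarrow> (\<exists>N\<ge>1. \<forall>n\<ge>N.
      inner_prob M {\<omega> \<in> space M.
        emp_risk cov l (sample Z n \<omega>) (f (k - 1) (\<theta>hat (k - 1) (sample Z n \<omega>)))
          - emp_risk cov l (sample Z n \<omega>) (f k (\<theta>hat k (sample Z n \<omega>)))
        \<le> \<gamma> k n \<delta>} \<ge> 1 - \<delta>))"
proof (intro conjI allI impI)
  let ?R = "\<lambda>k. risk P cov l (f k (\<theta>star k))"
  let ?D = "\<lambda>k n \<omega>. emp_risk cov l (sample Z n \<omega>) (f (k - 1) (\<theta>hat (k - 1) (sample Z n \<omega>)))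
    - emp_risk cov l (sample Z n \<omega>) (f k (\<theta>hat k (sample Z n \<omega>)))"
  let ?E = "\<lambda>k n \<delta>. {\<omega> \<in> space M. \<bar>?D k n \<omega> - ?R (k - 1) + ?R k\<bar> \<le> \<gamma> k n \<delta>}"
  have fin: "finite_measure M"
    using prob_M by (rule prob_space.finite_measure)
  have K_bounds: "1 \<le> K" "K \<le> L"
    using K by (auto simp: most_parsimonious_index_def)
  \<comment> \<open>The target events need not be measurable, as they involve arbitrary choices of
    minimizers. Inner probability is monotone on all sets, so a plain inclusion of events carries
    the bound over.\<close>
  have from_bound: "1 - \<delta> \<le> inner_prob M A"
    if "1 - \<delta> \<le> inner_prob M (?E k n \<delta>)" "?E k n \<delta> \<subseteq> A" for k n \<delta> A
    using that inner_prob_mono[OF fin] order.trans by blast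
  {
    fix \<delta> :: real
    assume "K \<ge> 2" and \<delta>: "0 < \<delta> \<and> \<delta> \<le> 1"
    then have k: "K \<in> {2..L}" "K - 1 \<in> {1..L}" "K \<in> {1..L}"
      using K_bounds by auto
    define \<epsilon> where "\<epsilon> = ?R (K - 1) - ?R K"
    have "\<theta>star (K - 1) \<in> H (K - 1)"
      using risk_min[OF k(2)] by (simp add: is_arg_min_linorder)
    then have "\<epsilon> > 0"
      using min_risk_less_if_most_parsimonious[OF K \<open>K \<ge> 2\<close> risk_min[OF k(3)]]
      by (simp add: \<epsilon>_def)
    \<comment> \<open>The gap \<epsilon> depends neither on \<open>n\<close> nor on the sample. The
      order o(1) holds for each fixed \<delta> separately, so the resulting threshold depends on
      \<delta>.\<close>
    then obtain n\<^sub>0 where n0: "\<And>n. n \<ge> n\<^sub>0 \<Longrightarrow> \<gamma> K n \<delta> \<le> \<epsilon> / 2"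
      using o1[OF k(1)] \<delta> unfolding order_o1_def by (meson half_gt_zero)
    obtain N where "N \<ge> 1" and N: "\<And>n. n \<ge> N \<Longrightarrow> 1 - \<delta> \<le> inner_prob M (?E K n \<delta>)"
      using bound[OF k(1)] \<delta> by blast
    have "1 - \<delta> \<le> inner_prob M {\<omega> \<in> space M. ?D K n \<omega> \<ge> \<gamma> K n \<delta>}" if "n \<ge> max N n\<^sub>0" for n
    proof (rule from_bound)
      show "1 - \<delta> \<le> inner_prob M (?E K n \<delta>)"
        using that N by simp
      \<comment> \<open>The lower half of the absolute value gives
        \<open>?D K n \<omega> \<ge> \<epsilon> - \<gamma> K n \<delta>\<close>, and both this bound
        and \<epsilon> / 2 dominate \<open>\<gamma> K n \<delta>\<close>.\<close>
      show "?E K n \<delta> \<subseteq> {\<omega> \<in> space M. ?D K n \<omega> \<ge> \<gamma> K n \<delta>}"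
        using n0[of n] that by (auto simp: \<epsilon>_def abs_le_iff)
    qed
    then show "\<exists>N\<ge>1. \<forall>n\<ge>N. inner_prob M {\<omega> \<in> space M. ?D K n \<omega> \<ge> \<gamma> K n \<delta>} \<ge> 1 - \<delta>"
      using \<open>N \<ge> 1\<close> by (intro exI[of _ "max N n\<^sub>0"]) auto
  next
    fix \<delta> :: real and k :: nat
    assume asm: "0 < \<delta> \<and> \<delta> \<le> 1 \<and> K < k \<and> k \<le> L"
    then have k: "k \<in> {2..L}" "k \<in> {1..L}" "k - 1 \<in> {1..L}" "K \<in> {1..L}"
      using K_bounds by auto
    \<comment> \<open>From \<open>K < k\<close> follows \<open>K \<le> k - 1\<close>; for
      \<open>k = K + 1\<close> this is nestedness of model \<open>K\<close> in itself.\<close>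
    have "nested X f H K (k - 1)"
      using nested asm K_bounds unfolding sequentially_nested_def
      by (metis add_le_imp_le_diff diff_le_self le_trans less_eq_Suc_le Suc_eq_plus1)
    then have "?R (k - 1) \<le> ?R K"
      using cov risk_min[OF k(4)] risk_min[OF k(3)] by (rule min_risk_antimono)
    moreover have "\<theta>star k \<in> H k"
      using risk_min[OF k(2)] by (simp add: is_arg_min_linorder)
    then have "?R K \<le> ?R k"
      using min_risk_le_if_most_parsimonious[OF K risk_min[OF k(4)] k(2)] by blast
    \<comment> \<open>The chain passes through the minimal risk of model \<open>K\<close>. The upper
      half of the absolute value in \<open>?E\<close> bounds \<open>?D k n \<omega>\<close> by
      \<open>\<gamma> k n \<delta>\<close> plus \<open>?R (k - 1) - ?R k\<close>, and this
      difference is now known to be at most 0.\<close>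
    ultimately have le: "?R (k - 1) \<le> ?R k" by simp
    obtain N where "N \<ge> 1" and N: "\<And>n. n \<ge> N \<Longrightarrow> 1 - \<delta> \<le> inner_prob M (?E k n \<delta>)"
      using bound[OF k(1)] asm by blast
    have "1 - \<delta> \<le> inner_prob M {\<omega> \<in> space M. ?D k n \<omega> \<le> \<gamma> k n \<delta>}" if "n \<ge> N" for n
    proof (rule from_bound[OF N[OF that]])
      show "?E k n \<delta> \<subseteq> {\<omega> \<in> space M. ?D k n \<omega> \<le> \<gamma> k n \<delta>}"
        using le by (auto simp: abs_le_iff)
    qed
    then show "\<exists>N\<ge>1. \<forall>n\<ge>N. inner_prob M {\<omega> \<in> space M. ?D k n \<omega> \<le> \<gamma> k n \<delta>} \<ge> 1 - \<delta>"
      using \<open>N \<ge> 1\<close> by blast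
  }
qed

end
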